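(* Let $(X,p)$ be a partial metric space and let $(X,G_p)$ be its associated G-metric space, where $$G_p(x,y,z)=p(x,y)+p(y,z)+p(x,z)-p(x,x)-p(y,y)-p(z,z)\quad\text{for all } x,y,z\in X.$$ Then the following statements hold. (A) A sequence $\{x_n\}_{n\ge1}$ in $X$ is Cauchy in $(X,p)$ if and only if it is G-Cauchy in $(X,G_p)$. (B) $(X,p)$ is complete if and only if $(X,G_p)$ is G-complete. Moreover, for every sequence $\{x_n\}_{n\ge1}$ in $X$ and every $x\in X$, $$\lim_{n,m\to\infty}G_p(x,x_n,x_m)=0\iff p(x,x)=\lim_{n,m\to\infty}p(x_n,x_m)=\lim_{n\to\infty}p(x_n,x_n)=\lim_{n\to\infty}p(x,x_n).$$
   Context: Let $X$ be a non-empty set. A partial metric on $X$ is a function $p:X\times X\to[0,\infty)$ such that for all $x,y,z\in X$: (P1) $x=y$ if and only if $p(x,x)=p(x,y)=p(y,y)$; (P2) $p(x,x)\le p(x,y)$; (P3) $p(x,y)=p(y,x)$; (P4) $p(x,z)\le p(x,y)+p(y,z)-p(y,y)$. The pair $(X,p)$ is a partial metric space. A sequence $\{x_n\}_{n\ge1}$ in $X$ converges to $x\in X$ in $(X,p)$ if $\lim_{n\to\infty}p(x_n,x)=p(x,x)$. It is Cauchy in $(X,p)$ if $\lim_{n,m\to\infty}p(x_n,x_m)$ exists and is finite. $(X,p)$ is complete if every Cauchy sequence $\{x_n\}_{n\ge1}$ converges to some point $x\in X$ such that $\lim_{n,m\to\infty}p(x_n,x_m)=p(x,x)$. A G-metric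 on $X$ is a function $G:X\times X\times X\to[0,\infty)$ such that: (G1) if $x=y=z$ then $G(x,y,z)=0$; (G2) $G(x,x,y)>0$ whenever $x\ne y$; (G3) $G(x,x,y)\le G(x,y,z)$ whenever $z\ne y$; (G4) $G$ is invariant under all permutations of its three arguments; (G5) $G(x,y,z)\le G(x,a,a)+G(a,y,z)$ for all $x,y,z,a\in X$. The function $G_p$ is a G-metric on $X$. A sequence $\{x_n\}_{n\ge1}$ is G-convergent to $x\in X$ if for every $\varepsilon>0$ there is $k\in\mathbb{N}$ with $G(x,x_n,x_m)<\varepsilon$ for all $n,m\ge k$. It is G-Cauchy if for every $\varepsilon>0$ there is $k\in\mathbb{N}$ with $G(x_n,x_m,x_l)<\varepsilon$ for all $n,m,l\ge k$. $(X,G)$ is G-complete if every G-Cauchy sequence in $X$ is G-convergent in $X$. *)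

theory Defs
  imports Complex_Main
begin

text \<open>
  Spaces have an explicit carrier \<open>X\<close>; functions are only constrained on \<open>X\<close>.  Sequences in \<open>X\<close>
  are functions on \<open>nat\<close> with range in \<open>X\<close>, so indexing starts at 0 rather than at 1.
  A double limit as \<open>n, m\<close> tend to infinity (independently) is a limit along
  \<open>sequentially \<times>\<^sub>F sequentially\<close>.
\<close>

locale partial_metric_space =
  fixes X :: "'a set" and p :: "'a \<Rightarrow> 'a \<Rightarrow> real"
  assumes nonempty: "X \<noteq> {}"
    and nonneg: "\<lbrakk>x \<in> X; y \<in> X\<rbrakk> \<Longrightarrow> 0 \<le> p x y"
    and P1: "\<lbrakk>x \<in> X; y \<in> X\<rbrakk> \<Longrightarrow> x = y \<longleftrightarrow> p x x = p x y \<and> p x y = p y y"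
    and P2: "\<lbrakk>x \<in> X; y \<in> X\<rbrakk> \<Longrightarrow> p x x \<le> p x y"
    and P3: "\<lbrakk>x \<in> X; y \<in> X\<rbrakk> \<Longrightarrow> p x y = p y x"
    and P4: "\<lbrakk>x \<in> X; y \<in> X; z \<in> X\<rbrakk> \<Longrightarrow> p x z \<le> p x y + p y z - p y y"

definition pm_converges :: "('a \<Rightarrow> 'a \<Rightarrow> real) \<Rightarrow> (nat \<Rightarrow> 'a) \<Rightarrow> 'a \<Rightarrow> bool" where
  "pm_converges p s x \<longleftrightarrow> (\<lambda>n. p (s n) x) \<longlonglongrightarrow> p x x"

definition pm_Cauchy :: "('a \<Rightarrow> 'a \<Rightarrow> real) \<Rightarrow> (nat \<Rightarrow> 'a) \<Rightarrow> bool" where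
  "pm_Cauchy p s \<longleftrightarrow>
     (\<exists>L. ((\<lambda>(n, m). p (s n) (s m)) \<longlongrightarrow> L) (sequentially \<times>\<^sub>F sequentially))"

definition pm_complete :: "'a set \<Rightarrow> ('a \<Rightarrow> 'a \<Rightarrow> real) \<Rightarrow> bool" where
  "pm_complete X p \<longleftrightarrow>
     (\<forall>s. range s \<subseteq> X \<and> pm_Cauchy p s \<longrightarrow>
        (\<exists>x\<in>X. pm_converges p s x \<and>
           ((\<lambda>(n, m). p (s n) (s m)) \<longlongrightarrow> p x x) (sequentially \<times>\<^sub>F sequentially)))"

locale G_metric_space =
  fixes X :: "'a set" and G :: "'a \<Rightarrow> 'a \<Rightarrow> 'a \<Rightarrow> real"
  assumes nonempty: "X \<noteq> {}"
    and nonneg: "\<lbrakk>x \<in> X; y \<in> X; z \<in> X\<rbrakk> \<Longrightarrow> 0 \<le> G x y z"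
    and G1: "x \<in> X \<Longrightarrow> G x x x = 0"
    and G2: "\<lbrakk>x \<in> X; y \<in> X; x \<noteq> y\<rbrakk> \<Longrightarrow> 0 < G x x y"
    and G3: "\<lbrakk>x \<in> X; y \<in> X; z \<in> X; z \<noteq> y\<rbrakk> \<Longrightarrow> G x x y \<le> G x y z"
    and G4: "\<lbrakk>x \<in> X; y \<in> X; z \<in> X\<rbrakk> \<Longrightarrow>
        G x y z = G x z y \<and> G x y z = G y x z \<and> G x y z = G y z x \<and>
        G x y z = G z x y \<and> G x y z = G z y x"
    and G5: "\<lbrakk>x \<in> X; y \<in> X; z \<in> X; a \<in> X\<rbrakk> \<Longrightarrow> G x y z \<le> G x a a + G a y z"

definition G_convergent_to :: "('a \<Rightarrow> 'a \<Rightarrow> 'a \<Rightarrow> real) \<Rightarrow> (nat \<Rightarrow> 'a) \<Rightarrow> 'a \<Rightarrow> bool" where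
  "G_convergent_to G s x \<longleftrightarrow> (\<forall>\<epsilon>>0. \<exists>k. \<forall>n\<ge>k. \<forall>m\<ge>k. G x (s n) (s m) < \<epsilon>)"

definition G_Cauchy :: "('a \<Rightarrow> 'a \<Rightarrow> 'a \<Rightarrow> real) \<Rightarrow> (nat \<Rightarrow> 'a) \<Rightarrow> bool" where
  "G_Cauchy G s \<longleftrightarrow> (\<forall>\<epsilon>>0. \<exists>k. \<forall>n\<ge>k. \<forall>m\<ge>k. \<forall>l\<ge>k. G (s n) (s m) (s l) < \<epsilon>)"

definition G_complete :: "'a set \<Rightarrow> ('a \<Rightarrow> 'a \<Rightarrow> 'a \<Rightarrow> real) \<Rightarrow> bool" where
  "G_complete X G \<longleftrightarrow>
     (\<forall>s. range s \<subseteq> X \<and> G_Cauchy G s \<longrightarrow> (\<exists>x\<in>X. G_convergent_to G s x))"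

definition G_of :: "('a \<Rightarrow> 'a \<Rightarrow> real) \<Rightarrow> 'a \<Rightarrow> 'a \<Rightarrow> 'a \<Rightarrow> real" where
  "G_of p x y z = p x y + p y z + p x z - p x x - p y y - p z z"

lemma (in partial_metric_space) G_metric_space_G_of: "G_metric_space X (G_of p)"
proof
  show "X \<noteq> {}" by (fact nonempty)
next
  fix x y z assume xyz: "x \<in> X" "y \<in> X" "z \<in> X"
  show "0 \<le> G_of p x y z"
    using P2[OF xyz(1,2)] P2[OF xyz(2,3)] P2[OF xyz(3,1)] P3[OF xyz(1,3)]
    by (simp add: G_of_def)
next
  fix x assume "x \<in> X"
  show "G_of p x x x = 0" by (simp add: G_of_def)
next
  fix x y assume xy: "x \<in> X" "y \<in> X" "x \<noteq> y"
  show "0 < G_of p x x y"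
    using P1[OF xy(1,2)] P2[OF xy(1,2)] P2[OF xy(2,1)] P3[OF xy(1,2)] xy(3)
    by (auto simp: G_of_def)
next
  fix x y z assume xyz: "x \<in> X" "y \<in> X" "z \<in> X"
  show "G_of p x x y \<le> G_of p x y z"
    using P4[OF xyz(1,3,2)] P3[OF xyz(2,3)] by (simp add: G_of_def)
next
  fix x y z assume xyz: "x \<in> X" "y \<in> X" "z \<in> X"
  show "G_of p x y z = G_of p x z y \<and> G_of p x y z = G_of p y x z \<and>
        G_of p x y z = G_of p y z x \<and> G_of p x y z = G_of p z x y \<and> G_of p x y z = G_of p z y x"
    using P3[OF xyz(1,2)] P3[OF xyz(2,3)] P3[OF xyz(1,3)] by (simp add: G_of_def)
next
  fix x y z a assume xyz: "x \<in> X" "y \<in> X" "z \<in> X" and a: "a \<in> X"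
  show "G_of p x y z \<le> G_of p x a a + G_of p a y z"
    using P4[OF xyz(1) a xyz(2)] P4[OF xyz(1) a xyz(3)] by (simp add: G_of_def)
qed

end

theory Submission
  imports Defs
begin

text \<open>
  Each of the nonnegative defects \<open>p x y - p x x\<close> is bounded by \<open>G_of p x y z\<close>, so every variation
  of \<open>p\<close> on the triple is controlled by \<open>G_of p\<close>, while \<open>G_of p\<close> is a linear
  combination of values of \<open>p\<close>. Hence both notions of limit and of Cauchy sequence agree; the limit of
  \<open>p (s n) (s m)\<close> along a G-Cauchy sequence is that of the real Cauchy sequence \<open>p (s n) (s n)\<close>.
\<close>

text \<open>Puts double limits into the shape of \<open>G_Cauchy\<close> and
  \<open>G_convergent_to\<close>: one threshold for all indices.\<close>

lemma double_LIMSEQ_iff: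
  fixes f :: "nat \<Rightarrow> nat \<Rightarrow> real"
  shows "((\<lambda>(n, m). f n m) \<longlongrightarrow> L) (sequentially \<times>\<^sub>F sequentially) \<longleftrightarrow>
    (\<forall>e>0. \<exists>k. \<forall>n\<ge>k. \<forall>m\<ge>k. \<bar>f n m - L\<bar> < e)"
  unfolding tendsto_iff eventually_prod_sequentially by (simp add: dist_real_def) blast

lemma double_LIMSEQ_diagonal:
  fixes f :: "nat \<Rightarrow> nat \<Rightarrow> real"
  assumes "((\<lambda>(n, m). f n m) \<longlongrightarrow> L) (sequentially \<times>\<^sub>F sequentially)"
  shows "(\<lambda>n. f n n) \<longlonglongrightarrow> L"
  using assms unfolding double_LIMSEQ_iff LIMSEQ_iff real_norm_def by blast

context partial_metric_space
begin

text \<open>By symmetry, \<open>G_of p x y z\<close> minus or plus \<open>p y z - p x x\<close>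
  regroups into a sum of terms of the form \<open>p a b - p a a\<close>, each nonnegative by
  \<open>P2\<close>.\<close>

lemma abs_diff_le_G_of:
  assumes "x \<in> X" "y \<in> X" "z \<in> X"
  shows "\<bar>p y z - p x x\<bar> \<le> G_of p x y z"
  using assms P2[of x y] P2[of y x] P2[of x z] P2[of z x] P2[of y z] P2[of z y]
    P3[of x y] P3[of y z] P3[of x z]
  by (simp add: G_of_def abs_le_iff)

lemma G_convergent_to_iff_tendsto:
  assumes "range s \<subseteq> X" "x \<in> X"
  shows "G_convergent_to (G_of p) s x \<longleftrightarrow>
    ((\<lambda>(n, m). G_of p x (s n) (s m)) \<longlongrightarrow> 0) (sequentially \<times>\<^sub>F sequentially)"
proof -
  interpret G: G_metric_space X "G_of p" by (rule G_metric_space_G_of)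
  have "\<bar>G_of p x (s n) (s m)\<bar> = G_of p x (s n) (s m)" for n m
    using assms by (intro abs_of_nonneg G.nonneg) auto
  then show ?thesis
    unfolding G_convergent_to_def double_LIMSEQ_iff by simp
qed

lemma G_of_tendsto_0_iff:
  assumes s: "range s \<subseteq> X" and x: "x \<in> X"
  shows "((\<lambda>(n, m). G_of p x (s n) (s m)) \<longlongrightarrow> 0) (sequentially \<times>\<^sub>F sequentially) \<longleftrightarrow>
    ((\<lambda>(n, m). p (s n) (s m)) \<longlongrightarrow> p x x) (sequentially \<times>\<^sub>F sequentially) \<and>
    (\<lambda>n. p (s n) (s n)) \<longlonglongrightarrow> p x x \<and> (\<lambda>n. p x (s n)) \<longlonglongrightarrow> p x x"
    (is "?G \<longleftrightarrow> ?pp \<and> ?diag \<and> ?px")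
proof (intro iffI conjI)
  have sX: "s n \<in> X" for n using s by auto
  assume ?G
  have "dist (p (s n) (s m)) (p x x) \<le> dist (G_of p x (s n) (s m)) 0" for n m
    using abs_diff_le_G_of[OF x sX[of n] sX[of m]] by (simp add: dist_real_def)
  then show ?pp
    by (intro metric_tendsto_imp_tendsto[OF \<open>?G\<close>] always_eventually) auto
  then show ?diag by (rule double_LIMSEQ_diagonal)
  \<comment> \<open>On the diagonal, \<open>G_of p x y y\<close> is the sum of the nonnegative terms
    \<open>p x y - p x x\<close> and \<open>p x y - p y y\<close>.\<close>
  have "dist (p x (s n)) (p x x) \<le> dist (G_of p x (s n) (s n)) 0" for n
    using P2[OF x sX[of n]] P2[OF sX[of n] x] P3[OF x sX[of n]] by (simp add: G_of_def dist_real_def)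
  then show ?px
    by (intro metric_tendsto_imp_tendsto[OF double_LIMSEQ_diagonal[OF \<open>?G\<close>]] always_eventually) auto
next
  assume "?pp \<and> ?diag \<and> ?px"
  then have pp: ?pp and diag: ?diag and px: ?px by auto
  let ?F = "sequentially \<times>\<^sub>F sequentially :: (nat \<times> nat) filter"
  \<comment> \<open>Composing with the projections turns the single limits \<open>px\<close> and
    \<open>diag\<close> into limits along \<open>?F\<close>, in either index.\<close>
  have "filterlim fst sequentially ?F" "filterlim snd sequentially ?F"
    by (simp_all add: filterlim_def filtermap_fst_prod_filter filtermap_snd_prod_filter)
  note lims = this[THEN filterlim_compose[OF px]] this[THEN filterlim_compose[OF diag]]
  have "((\<lambda>z. p x (s (fst z)) + p (s (fst z)) (s (snd z)) + p x (s (snd z)) - p x x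
      - p (s (fst z)) (s (fst z)) - p (s (snd z)) (s (snd z)))
      \<longlongrightarrow> p x x + p x x + p x x - p x x - p x x - p x x) ?F"
    by (intro tendsto_add tendsto_diff tendsto_const lims pp[unfolded case_prod_unfold])
  then show ?G by (simp add: G_of_def case_prod_unfold)
qed

lemma pm_Cauchy_iff_G_Cauchy:
  assumes s: "range s \<subseteq> X"
  shows "pm_Cauchy p s \<longleftrightarrow> G_Cauchy (G_of p) s"
proof
  assume "pm_Cauchy p s"
  then obtain L where L: "\<forall>e>0. \<exists>k. \<forall>n\<ge>k. \<forall>m\<ge>k. \<bar>p (s n) (s m) - L\<bar> < e"
    unfolding pm_Cauchy_def double_LIMSEQ_iff by auto
  show "G_Cauchy (G_of p) s"
    unfolding G_Cauchy_def
  proof (intro allI impI)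
    fix e :: real assume "0 < e"
    \<comment> \<open>\<open>G_of p\<close> adds three values of \<open>p\<close> and subtracts
      three, so \<open>L\<close> cancels and six errors below \<open>e / 6\<close> remain.\<close>
    then obtain k where k: "\<bar>p (s n) (s m) - L\<bar> < e / 6" if "n \<ge> k" "m \<ge> k" for n m
      using L[rule_format, of "e / 6"] by auto
    have "G_of p (s n) (s m) (s l) < e" if "n \<ge> k" "m \<ge> k" "l \<ge> k" for n m l
      using k[of n m] k[of m l] k[of n l] k[of n n] k[of m m] k[of l l] that
      unfolding G_of_def abs_less_iff by linarith
    then show "\<exists>k. \<forall>n\<ge>k. \<forall>m\<ge>k. \<forall>l\<ge>k. G_of p (s n) (s m) (s l) < e" by blast
  qed
next
  have sX: "s n \<in> X" for n using s by auto
  assume G: "G_Cauchy (G_of p) s"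
  have near: "\<exists>k. \<forall>n\<ge>k. \<forall>m\<ge>k. \<forall>l\<ge>k. \<bar>p (s m) (s l) - p (s n) (s n)\<bar> < e" if "0 < e" for e
  proof -
    obtain k where "\<forall>n\<ge>k. \<forall>m\<ge>k. \<forall>l\<ge>k. G_of p (s n) (s m) (s l) < e"
      using G \<open>0 < e\<close> unfolding G_Cauchy_def by blast
    then have "\<bar>p (s m) (s l) - p (s n) (s n)\<bar> < e" if "n \<ge> k" "m \<ge> k" "l \<ge> k" for n m l
      using abs_diff_le_G_of[OF sX[of n] sX[of m] sX[of l]] that by fastforce
    then show ?thesis by blast
  qed
  \<comment> \<open>The case \<open>m = l\<close> of \<open>near\<close> compares two
    self-distances.\<close>
  then have "Cauchy (\<lambda>n. p (s n) (s n))"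
    unfolding Cauchy_def dist_real_def by blast
  then obtain L where L: "(\<lambda>n. p (s n) (s n)) \<longlonglongrightarrow> L"
    using real_Cauchy_convergent unfolding convergent_def by auto
  have "\<exists>k. \<forall>n\<ge>k. \<forall>m\<ge>k. \<bar>p (s n) (s m) - L\<bar> < e" if "0 < e" for e
  proof -
    obtain k where k: "\<And>n m l. n \<ge> k \<Longrightarrow> m \<ge> k \<Longrightarrow> l \<ge> k \<Longrightarrow> \<bar>p (s m) (s l) - p (s n) (s n)\<bar> < e / 2"
      using near[of "e / 2"] \<open>0 < e\<close> by auto
    obtain k' where k': "\<And>n. n \<ge> k' \<Longrightarrow> \<bar>p (s n) (s n) - L\<bar> < e / 2"
      using L[unfolded LIMSEQ_iff, rule_format, of "e / 2"] \<open>0 < e\<close> by auto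
    have "\<bar>p (s n) (s m) - L\<bar> < e" if "n \<ge> max k k'" "m \<ge> max k k'" for n m
      \<comment> \<open>The triple \<open>(n, n, m)\<close> compares \<open>p (s n) (s m)\<close>
        with the self-distance of \<open>s n\<close>, which is close to \<open>L\<close>.\<close>
      using k[of n n m] k'[of n] that by linarith
    then show ?thesis by blast
  qed
  then show "pm_Cauchy p s"
    unfolding pm_Cauchy_def double_LIMSEQ_iff by blast
qed

text \<open>Cauchy sequences agree by \<open>pm_Cauchy_iff_G_Cauchy\<close>, and a point is a limit
  as demanded by \<open>pm_complete\<close> exactly when it is a G-limit.\<close>

lemma pm_complete_iff_G_complete: "pm_complete X p \<longleftrightarrow> G_complete X (G_of p)"
proof -
  have "pm_converges p s x \<and>
      ((\<lambda>(n, m). p (s n) (s m)) \<longlongrightarrow> p x x) (sequentially \<times>\<^sub>F sequentially) \<longleftrightarrow>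
      G_convergent_to (G_of p) s x" if "range s \<subseteq> X" "x \<in> X" for s x
  proof -
    have "p (s n) x = p x (s n)" for n
      using that by (intro P3) auto
    then show ?thesis
      unfolding pm_converges_def G_convergent_to_iff_tendsto[OF that] G_of_tendsto_0_iff[OF that]
      \<comment> \<open>\<open>pm_complete\<close> does not mention the limit of the self-distances;
        the diagonal of the double limit supplies it.\<close>
      using double_LIMSEQ_diagonal[of "\<lambda>n m. p (s n) (s m)" "p x x"] by auto
  qed
  then show ?thesis
    unfolding pm_complete_def G_complete_def
    by (simp add: pm_Cauchy_iff_G_Cauchy cong: conj_cong bex_cong)
qed

end

theorem lemma2p4:
  fixes X :: "'a set" and p :: "'a \<Rightarrow> 'a \<Rightarrow> real"
  assumes "partial_metric_space X p"
  shows "(\<forall>s. range s \<subseteq> X \<longrightarrow> (pm_Cauchy p s \<longleftrightarrow> G_Cauchy (G_of p) s)) \<and>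
    (pm_complete X p \<longleftrightarrow> G_complete X (G_of p)) \<and>
    (\<forall>s. \<forall>x\<in>X. range s \<subseteq> X \<longrightarrow>
      (((\<lambda>(n, m). G_of p x (s n) (s m)) \<longlongrightarrow> 0) (sequentially \<times>\<^sub>F sequentially) \<longleftrightarrow>
        ((\<lambda>(n, m). p (s n) (s m)) \<longlongrightarrow> p x x) (sequentially \<times>\<^sub>F sequentially) \<and>
        (\<lambda>n. p (s n) (s n)) \<longlonglongrightarrow> p x x \<and>
        (\<lambda>n. p x (s n)) \<longlonglongrightarrow> p x x))"
proof -
  interpret partial_metric_space X p by fact
  show ?thesis
    using pm_Cauchy_iff_G_Cauchy pm_complete_iff_G_complete G_of_tendsto_0_iff by blast
qed

end
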